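(* Let $X$ and $B$ be monoids and let $(\varphi,\rho,\gamma)$ be a pseudo-action of $B$ on $X$, written $\varphi_b(x)=b\cdot x$, $\rho(x,b)=x^b$, $\gamma(b,b')=b\times b'$. If $X$ is right cancellable and $B$ is a group, then the correction system is trivial, that is, $x^b=x$ for all $x\in X$ and $b\in B$.
   Context: A monoid $X$ (additive) is right cancellable if $x+z=y+z$ implies $x=y$ for all $x,y,z\in X$. A pseudo-action of a monoid $B$ (multiplicative, not necessarily commutative) on a monoid $X$ (additive, not necessarily commutative) is a triple $(\varphi,\rho,\gamma)$ where: (1) $\varphi\colon B\to X^X$ (pre-action), written $\varphi_b(x)=b\cdot x$, satisfies $1\cdot x=x$ for all $x\in X$ and $b\cdot 0=0$ for all $b\in B$; (2) $\rho\colon X\times B\to X$ (correction system), written $\rho(x,b)=x^b$, satisfies $x^1=x$ and $0^b=0$ for all $x\in X$, $b\in B$; (3) $\gamma\colon B\times B\to X$ (factor system), written $\gamma(b,b')=b\times b'$, satisfies $1\times b=0=b\times 1$ for all $b\in B$; and for all $x,x',x''\in X$ and $b,b',b''\in B$, $$\bigl(x+b\cdot((x'+b'\cdot x''+(b'\times b''))^{b'b''})+(b\times b'b'')\bigr)^{bb'b''}=\bigl((x+b\cdot x'+(b\times b'))^{bb'}+bb'\cdot x''+(bb'\times b'')\bigr)^{bb'b''}.$$ *)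

theory Defs
  imports "HOL-Algebra.Group"
begin

text \<open>
  The monoid \<open>X\<close>, written additively in the mathematics, is an ordinary monoid record here:
  \<open>x \<otimes>\<^bsub>X\<^esub> y\<close> stands for $x + y$ and \<open>\<one>\<^bsub>X\<^esub>\<close> for $0$.  The maps are curried:
  \<open>\<phi> b x\<close> is $b \cdot x$, \<open>\<rho> x b\<close> is $x^b$ and \<open>\<gamma> b b'\<close> is $b \times b'$.
\<close>

definition right_cancellable :: "('x, 'm) monoid_scheme \<Rightarrow> bool" where
  "right_cancellable X \<longleftrightarrow>
     (\<forall>x\<in>carrier X. \<forall>y\<in>carrier X. \<forall>z\<in>carrier X.
        x \<otimes>\<^bsub>X\<^esub> z = y \<otimes>\<^bsub>X\<^esub> z \<longrightarrow> x = y)"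

definition pre_action ::
    "('b, 'n) monoid_scheme \<Rightarrow> ('x, 'm) monoid_scheme \<Rightarrow> ('b \<Rightarrow> 'x \<Rightarrow> 'x) \<Rightarrow> bool" where
  "pre_action B X \<phi> \<longleftrightarrow>
     \<phi> \<in> carrier B \<rightarrow> carrier X \<rightarrow> carrier X \<and>
     (\<forall>x\<in>carrier X. \<phi> \<one>\<^bsub>B\<^esub> x = x) \<and>
     (\<forall>b\<in>carrier B. \<phi> b \<one>\<^bsub>X\<^esub> = \<one>\<^bsub>X\<^esub>)"

definition correction_system ::
    "('b, 'n) monoid_scheme \<Rightarrow> ('x, 'm) monoid_scheme \<Rightarrow> ('x \<Rightarrow> 'b \<Rightarrow> 'x) \<Rightarrow> bool" where
  "correction_system B X \<rho> \<longleftrightarrow>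
     \<rho> \<in> carrier X \<rightarrow> carrier B \<rightarrow> carrier X \<and>
     (\<forall>x\<in>carrier X. \<rho> x \<one>\<^bsub>B\<^esub> = x) \<and>
     (\<forall>b\<in>carrier B. \<rho> \<one>\<^bsub>X\<^esub> b = \<one>\<^bsub>X\<^esub>)"

definition factor_system ::
    "('b, 'n) monoid_scheme \<Rightarrow> ('x, 'm) monoid_scheme \<Rightarrow> ('b \<Rightarrow> 'b \<Rightarrow> 'x) \<Rightarrow> bool" where
  "factor_system B X \<gamma> \<longleftrightarrow>
     \<gamma> \<in> carrier B \<rightarrow> carrier B \<rightarrow> carrier X \<and>
     (\<forall>b\<in>carrier B. \<gamma> \<one>\<^bsub>B\<^esub> b = \<one>\<^bsub>X\<^esub> \<and> \<gamma> b \<one>\<^bsub>B\<^esub> = \<one>\<^bsub>X\<^esub>)"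

definition pseudo_action ::
    "('b, 'n) monoid_scheme \<Rightarrow> ('x, 'm) monoid_scheme \<Rightarrow>
     ('b \<Rightarrow> 'x \<Rightarrow> 'x) \<Rightarrow> ('x \<Rightarrow> 'b \<Rightarrow> 'x) \<Rightarrow> ('b \<Rightarrow> 'b \<Rightarrow> 'x) \<Rightarrow> bool" where
  "pseudo_action B X \<phi> \<rho> \<gamma> \<longleftrightarrow>
     pre_action B X \<phi> \<and> correction_system B X \<rho> \<and> factor_system B X \<gamma> \<and>
     (\<forall>x\<in>carrier X. \<forall>x'\<in>carrier X. \<forall>x''\<in>carrier X.
      \<forall>b\<in>carrier B. \<forall>b'\<in>carrier B. \<forall>b''\<in>carrier B.
        \<rho> (x \<otimes>\<^bsub>X\<^esub> \<phi> b (\<rho> (x' \<otimes>\<^bsub>X\<^esub> \<phi> b' x'' \<otimes>\<^bsub>X\<^esub> \<gamma> b' b'') (b' \<otimes>\<^bsub>B\<^esub> b''))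
             \<otimes>\<^bsub>X\<^esub> \<gamma> b (b' \<otimes>\<^bsub>B\<^esub> b''))
          (b \<otimes>\<^bsub>B\<^esub> b' \<otimes>\<^bsub>B\<^esub> b'')
        = \<rho> (\<rho> (x \<otimes>\<^bsub>X\<^esub> \<phi> b x' \<otimes>\<^bsub>X\<^esub> \<gamma> b b') (b \<otimes>\<^bsub>B\<^esub> b')
             \<otimes>\<^bsub>X\<^esub> \<phi> (b \<otimes>\<^bsub>B\<^esub> b') x'' \<otimes>\<^bsub>X\<^esub> \<gamma> (b \<otimes>\<^bsub>B\<^esub> b') b'')
          (b \<otimes>\<^bsub>B\<^esub> b' \<otimes>\<^bsub>B\<^esub> b''))"

end

theory Submission
  imports Defs
begin

theorem mainTheorem4:
  fixes X :: "('x, 'm) monoid_scheme" and B :: "('b, 'n) monoid_scheme"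
    and \<phi> :: "'b \<Rightarrow> 'x \<Rightarrow> 'x" and \<rho> :: "'x \<Rightarrow> 'b \<Rightarrow> 'x" and \<gamma> :: "'b \<Rightarrow> 'b \<Rightarrow> 'x"
  assumes "monoid X" and "monoid B"
    and "pseudo_action B X \<phi> \<rho> \<gamma>"
    and "right_cancellable X"
    and "group B"
  shows "\<forall>x\<in>carrier X. \<forall>b\<in>carrier B. \<rho> x b = x"
proof (intro ballI)
  fix x b
  assume x: "x \<in> carrier X" and b: "b \<in> carrier B"
  interpret X: monoid X by fact
  interpret B: group B by fact
  \<comment> \<open>This is where the group structure of \<open>B\<close> enters: \<open>?c\<close>
    makes a product ending in \<open>b\<close> followed by \<open>?c\<close> collapse to the
    identity, the one exponent at which \<open>\<rho>\<close> is known to do nothing.\<close>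
  let ?c = "inv\<^bsub>B\<^esub> b"
  have c: "?c \<in> carrier B"
    using b by simp
  \<comment> \<open>\<open>\<phi>\<close> is only ever applied to the identity of \<open>X\<close>
    below, so \<open>\<phi>0\<close> covers its values and their membership in the carrier. Closure
    of \<open>\<rho>\<close> and \<open>\<gamma>\<close> is what lets \<open>\<rho>1\<close> and
    cancellation apply to sums involving them.\<close>
  have \<phi>0: "\<And>b. b \<in> carrier B \<Longrightarrow> \<phi> b \<one>\<^bsub>X\<^esub> = \<one>\<^bsub>X\<^esub>"
    and \<rho>_closed: "\<And>x b. x \<in> carrier X \<Longrightarrow> b \<in> carrier B \<Longrightarrow> \<rho> x b \<in> carrier X"
    and \<rho>1: "\<And>x. x \<in> carrier X \<Longrightarrow> \<rho> x \<one>\<^bsub>B\<^esub> = x"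
    and \<rho>0: "\<And>b. b \<in> carrier B \<Longrightarrow> \<rho> \<one>\<^bsub>X\<^esub> b = \<one>\<^bsub>X\<^esub>"
    and \<gamma>_closed: "\<And>b b'. b \<in> carrier B \<Longrightarrow> b' \<in> carrier B \<Longrightarrow> \<gamma> b b' \<in> carrier X"
    and \<gamma>1: "\<And>b. b \<in> carrier B \<Longrightarrow> \<gamma> \<one>\<^bsub>B\<^esub> b = \<one>\<^bsub>X\<^esub>" "\<And>b. b \<in> carrier B \<Longrightarrow> \<gamma> b \<one>\<^bsub>B\<^esub> = \<one>\<^bsub>X\<^esub>"
    using assms(3)
    unfolding pseudo_action_def pre_action_def correction_system_def factor_system_def
    by blast+
  \<comment> \<open>The axiom with \<open>x' = x'' = 0\<close>, \<open>b' = 1\<close> and \<open>b'' = b\<^sup>-\<^sup>1\<close>: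
    the outer exponent \<open>b b' b''\<close> is \<open>1\<close>, so the outer correction disappears.\<close>
  have "\<rho> (x \<otimes>\<^bsub>X\<^esub> \<phi> b (\<rho> (\<one>\<^bsub>X\<^esub> \<otimes>\<^bsub>X\<^esub> \<phi> \<one>\<^bsub>B\<^esub> \<one>\<^bsub>X\<^esub> \<otimes>\<^bsub>X\<^esub> \<gamma> \<one>\<^bsub>B\<^esub> ?c) (\<one>\<^bsub>B\<^esub> \<otimes>\<^bsub>B\<^esub> ?c))
             \<otimes>\<^bsub>X\<^esub> \<gamma> b (\<one>\<^bsub>B\<^esub> \<otimes>\<^bsub>B\<^esub> ?c))
          (b \<otimes>\<^bsub>B\<^esub> \<one>\<^bsub>B\<^esub> \<otimes>\<^bsub>B\<^esub> ?c)
        = \<rho> (\<rho> (x \<otimes>\<^bsub>X\<^esub> \<phi> b \<one>\<^bsub>X\<^esub> \<otimes>\<^bsub>X\<^esub> \<gamma> b \<one>\<^bsub>B\<^esub>) (b \<otimes>\<^bsub>B\<^esub> \<one>\<^bsub>B\<^esub>)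
             \<otimes>\<^bsub>X\<^esub> \<phi> (b \<otimes>\<^bsub>B\<^esub> \<one>\<^bsub>B\<^esub>) \<one>\<^bsub>X\<^esub> \<otimes>\<^bsub>X\<^esub> \<gamma> (b \<otimes>\<^bsub>B\<^esub> \<one>\<^bsub>B\<^esub>) ?c)
          (b \<otimes>\<^bsub>B\<^esub> \<one>\<^bsub>B\<^esub> \<otimes>\<^bsub>B\<^esub> ?c)"
    using assms(3) x b c X.one_closed B.one_closed unfolding pseudo_action_def by blast
  \<comment> \<open>On the left the inner correction acts on 0 and vanishes. On the right the inner
    sum reduces to \<open>x\<close>, but its exponent is \<open>b\<close>, so
    \<open>\<rho> x b\<close> survives.\<close>
  then have "x \<otimes>\<^bsub>X\<^esub> \<gamma> b ?c = \<rho> x b \<otimes>\<^bsub>X\<^esub> \<gamma> b ?c"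
    using x b c by (simp add: \<phi>0 \<rho>_closed \<rho>1 \<rho>0 \<gamma>_closed \<gamma>1)
  \<comment> \<open>The axioms for \<open>\<gamma>\<close> fix its value only when an argument is 1,
    so the common right summand \<open>\<gamma> b ?c\<close> is cancelled rather than
    evaluated.\<close>
  then show "\<rho> x b = x"
    using assms(4) x \<rho>_closed[OF x b] \<gamma>_closed[OF b c] unfolding right_cancellable_def by metis
qed

end
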